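(* For every $n_0\in\mathbb{N}$ and every integer $\Delta\geq 3$ there exist $n\geq n_0$ and a connected $\Delta$-regular graph $G$ on $n$ vertices such that, if $\alpha$ is chosen uniformly at random from the set $\Omega(G)$ of proper $(\Delta+1)$-colourings of $G$, then $$\mathbb{P}(\alpha\text{ is frozen})\geq e^{-\frac{3\log(\Delta)}{\Delta}\cdot n}.$$
   Context: All graphs are finite, simple and labeled. A (proper) $k$-colouring of $G$ is a function $\alpha:V(G)\to[k]$ with $\alpha(x)\neq\alpha(y)$ for every edge $xy$. For $G$ of maximum degree $\Delta$, a proper $(\Delta+1)$-colouring of $G$ is frozen if for every vertex $v$ all $\Delta+1$ colours appear in the closed neighbourhood $N[v]=N(v)\cup\{v\}$. $\log$ is the natural logarithm. *)

theory Defs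
  imports
    "Graph_Theory.Graph_Theory"
    "HOL-Library.FuncSet"
    "HOL-Probability.Probability_Mass_Function"
begin

definition neighbourhood :: "('a, 'b) pre_digraph \<Rightarrow> 'a \<Rightarrow> 'a set" where
  "neighbourhood G v = {w. (v, w) \<in> arcs_ends G}"

definition closed_neighbourhood :: "('a, 'b) pre_digraph \<Rightarrow> 'a \<Rightarrow> 'a set" where
  "closed_neighbourhood G v = insert v (neighbourhood G v)"

text \<open>
  Graphs are symmetric digraphs, so the degree of a vertex is its number of outgoing arcs.
\<close>

definition regular :: "nat \<Rightarrow> ('a, 'b) pre_digraph \<Rightarrow> bool" where
  "regular d G \<longleftrightarrow> (\<forall>v \<in> verts G. out_degree G v = d)"

text \<open>
  Colourings are functions on the vertex set only: outside of it they take the default value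
  \<^term>\<open>undefined\<close>, so that \<open>proper_colourings\<close> counts each colouring once.
\<close>

definition proper_colourings :: "nat \<Rightarrow> ('a, 'b) pre_digraph \<Rightarrow> ('a \<Rightarrow> nat) set" where
  "proper_colourings k G =
     {\<alpha> \<in> verts G \<rightarrow>\<^sub>E {1..k}. \<forall>(x, y) \<in> arcs_ends G. \<alpha> x \<noteq> \<alpha> y}"

text \<open>In \<open>frozen d G \<alpha>\<close>, the number \<open>d\<close> is the maximum degree of \<open>G\<close>.\<close>

definition frozen :: "nat \<Rightarrow> ('a, 'b) pre_digraph \<Rightarrow> ('a \<Rightarrow> nat) \<Rightarrow> bool" where
  "frozen d G \<alpha> \<longleftrightarrow> \<alpha> \<in> proper_colourings (d + 1) G \<and>
     (\<forall>v \<in> verts G. \<forall>c \<in> {1..d + 1}. \<exists>w \<in> closed_neighbourhood G v. \<alpha> w = c)"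

text \<open>
  The uniform distribution \<^const>\<open>pmf_of_set\<close> is only meaningful on finite nonempty sets; the
  following two facts show that this is the case for the colourings considered here.
\<close>

lemma finite_proper_colourings:
  assumes "finite (verts G)"
  shows "finite (proper_colourings k G)"
  unfolding proper_colourings_def
  by (rule finite_subset[OF _ finite_PiE[OF assms, of "\<lambda>_. {1..k}"]]) auto

lemma (in pair_graph) proper_colourings_nonempty:
  assumes "regular d (with_proj G)"
  shows "proper_colourings (d + 1) (with_proj G) \<noteq> {}"
proof -
  have fin: "finite (pverts G)" by simp
  have "\<exists>\<alpha>. \<alpha> \<in> S \<rightarrow>\<^sub>E {1..d + 1} \<and> (\<forall>x\<in>S. \<forall>y\<in>S. (x, y) \<in> parcs G \<longrightarrow> \<alpha> x \<noteq> \<alpha> y)"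
    if "S \<subseteq> pverts G" for S
    using finite_subset[OF that fin] that
  proof (induction S rule: finite_induct)
    case empty
    then show ?case by auto
  next
    case (insert v S)
    have "S \<subseteq> pverts G" using insert.prems by simp
    from insert.IH[OF this] obtain \<alpha> where a: "\<alpha> \<in> S \<rightarrow>\<^sub>E {1..d + 1}"
      and pr: "\<forall>x\<in>S. \<forall>y\<in>S. (x, y) \<in> parcs G \<longrightarrow> \<alpha> x \<noteq> \<alpha> y"
      by (elim exE conjE)
    have p: "\<alpha> x \<noteq> \<alpha> y" if "x \<in> S" "y \<in> S" "(x, y) \<in> parcs G" for x y
      using pr[rule_format, OF that] .
    let ?A = "out_arcs (with_proj G) v"
    have finA: "finite ?A"
      by (rule finite_subset[OF _ pair_finite_arcs]) (auto simp: out_arcs_def)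
    have cA: "card ?A = d"
      using assms insert.prems by (auto simp: regular_def out_degree_def)
    have "card ((\<lambda>e. \<alpha> (snd e)) ` ?A) \<le> d"
      using card_image_le[OF finA] cA by metis
    then have "\<not> {1..d + 1} \<subseteq> (\<lambda>e. \<alpha> (snd e)) ` ?A"
      using card_mono[of "(\<lambda>e. \<alpha> (snd e)) ` ?A" "{1..d + 1}"] finA by auto
    then obtain c where c: "c \<in> {1..d + 1}" "c \<notin> (\<lambda>e. \<alpha> (snd e)) ` ?A" by blast
    have nc: "c \<noteq> \<alpha> y" if "(v, y) \<in> parcs G" for y
    proof
      assume "c = \<alpha> y"
      then have "c = \<alpha> (snd (v, y))" by simp
      moreover have "(v, y) \<in> ?A" using that by (simp add: out_arcs_def)
      ultimately show False using c(2) by blast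
    qed
    have sym: "(y, x) \<in> parcs G" if "(x, y) \<in> parcs G" for x y
      using that arcs_ends_symmetric[OF pair_sym_arcs, of x y] by simp
    have nl: "(x, x) \<notin> parcs G" for x
      using no_loops' by blast
    have "\<alpha>(v := c) \<in> insert v S \<rightarrow>\<^sub>E {1..d + 1}"
      using a c(1) by (rule PiE_fun_upd[rotated])
    moreover have "\<forall>x\<in>insert v S. \<forall>y\<in>insert v S. (x, y) \<in> parcs G \<longrightarrow>
        (\<alpha>(v := c)) x \<noteq> (\<alpha>(v := c)) y"
    proof (intro ballI impI)
      fix x y assume xy: "x \<in> insert v S" "y \<in> insert v S" "(x, y) \<in> parcs G"
      consider "x = v" "y = v" | "x = v" "y \<noteq> v" | "x \<noteq> v" "y = v" | "x \<noteq> v" "y \<noteq> v" by blast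
      then show "(\<alpha>(v := c)) x \<noteq> (\<alpha>(v := c)) y"
      proof cases
        case 1
        then show ?thesis using xy(3) nl[of v] by simp
      next
        case 2
        then show ?thesis using xy(3) nc[of y] by simp
      next
        case 3
        then have "c \<noteq> \<alpha> x" using sym[OF xy(3)] nc[of x] by simp
        then show ?thesis using 3 by simp
      next
        case 4
        then show ?thesis using xy p[of x y] by simp
      qed
    qed
    ultimately show ?case by (intro exI conjI)
  qed
  from this[OF subset_refl] obtain \<alpha> where "\<alpha> \<in> pverts G \<rightarrow>\<^sub>E {1..d + 1}"
    "\<forall>x\<in>pverts G. \<forall>y\<in>pverts G. (x, y) \<in> parcs G \<longrightarrow> \<alpha> x \<noteq> \<alpha> y"
    by (elim exE conjE)
  then have "\<alpha> \<in> proper_colourings (d + 1) (with_proj G)"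
    using wellformed' by (simp add: proper_colourings_def) blast
  then show ?thesis by blast
qed

end

theory Submission
  imports Defs
begin

text \<open>
  Take a ring of \<open>m\<close> copies of the complete graph on \<open>\<Delta> + 1\<close> vertices, each with one edge
  \<open>u\<^sub>i v\<^sub>i\<close> deleted, joined by the edges \<open>v\<^sub>i u\<^bsub>i+1\<^esub>\<close>. Within a copy, all vertices but \<open>v\<^sub>i\<close>
  form a clique and \<open>v\<^sub>i\<close> has \<open>\<Delta> - 1\<close> distinctly coloured neighbours there, so a copy has at most
  \<open>2 (\<Delta> + 1)!\<close> proper colourings. Conversely, colouring all \<open>u\<^sub>i\<close> by \<open>1\<close>, all \<open>v\<^sub>i\<close> by \<open>\<Delta> + 1\<close>
  and the remaining \<open>\<Delta> - 1\<close> vertices of each copy by an arbitrary bijection to \<open>{2..\<Delta>}\<close> gives a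
  frozen colouring. The proportion of frozen colourings is therefore at least
  \<open>(2 \<Delta> (\<Delta> + 1))\<^sup>-\<^sup>m \<ge> \<Delta>\<^sup>-\<^sup>3\<^sup>m\<close>, and \<open>n = m (\<Delta> + 1)\<close>.
\<close>

section \<open>Counting injective functions\<close>

lemma card_inj_funcset:
  assumes "finite A" "finite C"
  shows "card {f \<in> A \<rightarrow>\<^sub>E C. inj_on f A} = (\<Prod>i<card A. card C - i)"
  using card_inj_on_subset_funcset[OF assms subset_refl]
  by (simp add: atLeast0LessThan)

lemma prod_diff_eq_fact: "(\<Prod>i<n. n - i) = fact n"
  by (induction n) (simp_all add: prod.lessThan_Suc_shift del: prod.lessThan_Suc)

section \<open>The ring of blocks\<close>

locale block_ring =
  fixes d m :: nat
  assumes d: "d \<ge> 2" and m: "m > 0"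
begin

text \<open>
  The vertex \<open>i * (d + 1) + j\<close> is the vertex at position \<open>j \<le> d\<close> of block \<open>i < m\<close>; the deleted
  edge of a block joins the positions \<open>0\<close> and \<open>d\<close>. Every vertex has exactly one neighbour at each
  position other than its own, and \<open>nbr_block i j k\<close> is the block of the neighbour at position \<open>k\<close>
  of the vertex at position \<open>j\<close> of block \<open>i\<close>.
\<close>

definition nbr_block :: "nat \<Rightarrow> nat \<Rightarrow> nat \<Rightarrow> nat" where
  "nbr_block i j k =
     (if j = 0 \<and> k = d then (if i = 0 then m - 1 else i - 1)
      else if j = d \<and> k = 0 then (if Suc i = m then 0 else Suc i)
      else i)"

definition nbr :: "nat \<Rightarrow> nat \<Rightarrow> nat" where
  "nbr x k = nbr_block (x div (d + 1)) (x mod (d + 1)) k * (d + 1) + k"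

definition ring :: "nat pair_pre_digraph" where
  "ring = \<lparr> pverts = {..<m * (d + 1)},
     parcs = {(x, nbr x k) | x k. x < m * (d + 1) \<and> k \<le> d \<and> k \<noteq> x mod (d + 1)} \<rparr>"

lemma nbr_block_less: "i < m \<Longrightarrow> nbr_block i j k < m"
  using m by (auto simp: nbr_block_def)

text \<open>The cases \<open>0, d\<close> and \<open>d, 0\<close> swap, and cyclic predecessor and
  successor invert each other. Symmetry of the ring rests on this.\<close>

lemma nbr_block_involution: "i < m \<Longrightarrow> nbr_block (nbr_block i j k) k j = i"
  using m d by (auto simp: nbr_block_def)

lemma vertex_div: "k \<le> d \<Longrightarrow> (i * (d + 1) + k) div (d + 1) = i"
  by (metis Suc_eq_plus1 add.right_neutral div_less div_mult_self3 le_imp_less_Suc nat.distinct(1))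

lemma vertex_mod: "k \<le> d \<Longrightarrow> (i * (d + 1) + k) mod (d + 1) = k"
  by (metis Suc_eq_plus1 le_imp_less_Suc mod_less mod_mult_self3)

lemma vertex_less: "i < m \<Longrightarrow> k \<le> d \<Longrightarrow> i * (d + 1) + k < m * (d + 1)"
proof -
  assume "i < m" "k \<le> d"
  then have "i * (d + 1) + k < (i + 1) * (d + 1)" by simp
  also have "\<dots> \<le> m * (d + 1)" using \<open>i < m\<close> by (intro mult_right_mono) auto
  finally show ?thesis .
qed

lemma block_less: "x < m * (d + 1) \<Longrightarrow> x div (d + 1) < m"
  by (simp add: less_mult_imp_div_less)

lemma position_le: "x mod (d + 1) \<le> d"
  using mod_less_divisor[of "d + 1" x] by linarith

lemma nbr_div: "k \<le> d \<Longrightarrow> nbr x k div (d + 1) = nbr_block (x div (d + 1)) (x mod (d + 1)) k"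
  unfolding nbr_def by (rule vertex_div)

lemma nbr_mod: "k \<le> d \<Longrightarrow> nbr x k mod (d + 1) = k"
  unfolding nbr_def by (rule vertex_mod)

lemma nbr_less: "x < m * (d + 1) \<Longrightarrow> k \<le> d \<Longrightarrow> nbr x k < m * (d + 1)"
  unfolding nbr_def by (intro vertex_less nbr_block_less block_less)

lemma nbr_involution:
  assumes "x < m * (d + 1)" "k \<le> d"
  shows "nbr (nbr x k) (x mod (d + 1)) = x"
proof -
  have "nbr (nbr x k) (x mod (d + 1)) = x div (d + 1) * (d + 1) + x mod (d + 1)"
    unfolding nbr_def[of "nbr x k"] nbr_div[OF assms(2)] nbr_mod[OF assms(2)]
    using nbr_block_involution[OF block_less[OF assms(1)]] by simp
  then show ?thesis by (simp only: div_mult_mod_eq)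
qed

lemma pverts_ring: "pverts ring = {..<m * (d + 1)}"
  by (simp add: ring_def)

lemma arcs_ring_iff: "(x, y) \<in> parcs ring \<longleftrightarrow>
    x < m * (d + 1) \<and> (\<exists>k \<le> d. k \<noteq> x mod (d + 1) \<and> y = nbr x k)"
  by (auto simp: ring_def)

lemma arcs_ends_ring: "arcs_ends (with_proj ring) = parcs ring"
  by (auto simp: arcs_ends_def arc_to_ends_def)

lemma ring_sym: "(x, y) \<in> parcs ring \<Longrightarrow> (y, x) \<in> parcs ring"
  unfolding arcs_ring_iff
  by (metis nbr_involution nbr_less nbr_mod position_le)

lemma pair_graph_ring: "pair_graph ring"
proof
  show "fst e \<in> pverts ring" if "e \<in> parcs ring" for e
    using that by (cases e) (auto simp: pverts_ring arcs_ring_iff)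
  show snd: "snd e \<in> pverts ring" if "e \<in> parcs ring" for e
    using that by (cases e) (auto simp: pverts_ring arcs_ring_iff intro: nbr_less[simplified])
  show "finite (pverts ring)" by (simp add: pverts_ring)
  have "parcs ring \<subseteq> {..<m * (d + 1)} \<times> {..<m * (d + 1)}"
    using snd by (auto simp: pverts_ring arcs_ring_iff intro: nbr_less[simplified])
  then show "finite (parcs ring)" by (rule finite_subset) simp
  show "fst e \<noteq> snd e" if "e \<in> parcs ring" for e
    using that by (cases e) (metis arcs_ring_iff fst_conv nbr_mod snd_conv)
  show "symmetric (with_proj ring)"
    unfolding symmetric_def arcs_ends_ring by (rule symI) (rule ring_sym)
qed

lemma regular_ring: "regular d (with_proj ring)"
  unfolding regular_def
proof
  fix v assume "v \<in> verts (with_proj ring)"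
  then have v: "v < m * (d + 1)" by (simp add: pverts_ring)
  have "out_arcs (with_proj ring) v = (\<lambda>k. (v, nbr v k)) ` ({..d} - {v mod (d + 1)})"
    using v by (auto simp: out_arcs_def ring_def)
  \<comment> \<open>The position of \<open>nbr v k\<close> is \<open>k\<close>, so different
    \<open>k\<close> give different arcs.\<close>
  moreover have "inj_on (\<lambda>k. (v, nbr v k)) ({..d} - {v mod (d + 1)})"
    by (rule inj_onI) (metis DiffD1 atMost_iff nbr_mod prod.inject)
  ultimately have "out_degree (with_proj ring) v = card ({..d} - {v mod (d + 1)})"
    by (simp add: out_degree_def card_image)
  also have "\<dots> = d" using position_le[of v] by simp
  finally show "out_degree (with_proj ring) v = d" .
qed

text \<open>The order of the vertices is a Hamiltonian path.\<close>

lemma arc_Suc: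
  assumes "Suc x < m * (d + 1)"
  shows "(x, Suc x) \<in> parcs ring"
proof (cases "x mod (d + 1) = d")
  case True
  have eq: "Suc x = Suc (x div (d + 1)) * (d + 1)"
    using div_mult_mod_eq[of x "d + 1"] True by simp
  then have "Suc (x div (d + 1)) < m" using assms
    by (metis mult_less_cancel2)
  then have "nbr x 0 = Suc x"
    unfolding nbr_def eq using True d by (simp add: nbr_block_def)
  then show ?thesis
    using True assms d unfolding arcs_ring_iff by (intro conjI exI[of _ 0]) auto
next
  case False
  then have less: "Suc (x mod (d + 1)) \<le> d"
    using position_le[of x] by (metis le_neq_implies_less Suc_leI)
  \<comment> \<open>As \<open>d \<ge> 2\<close>, successive positions are never the deleted pair
    \<open>0\<close>, \<open>d\<close>.\<close>
  have "nbr x (Suc (x mod (d + 1))) = Suc (x div (d + 1) * (d + 1) + x mod (d + 1))"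
    unfolding nbr_def using d by (simp add: nbr_block_def)
  also have "\<dots> = Suc x" by (simp only: div_mult_mod_eq)
  finally show ?thesis
    using less assms unfolding arcs_ring_iff
    by (intro conjI exI[of _ "Suc (x mod (d + 1))"]) auto
qed

lemma connected_ring: "Digraph_Component.connected (with_proj ring)"
proof -
  interpret G: pair_graph ring by (rule pair_graph_ring)
  have reach: "0 \<rightarrow>\<^sup>*\<^bsub>with_proj ring\<^esub> x" if "x < m * (d + 1)" for x
    using that
  proof (induction x)
    case 0
    then show ?case by (intro G.reachable_refl) (simp add: pverts_ring)
  next
    case (Suc x)
    then show ?case
      using G.reachable_adj_trans[of 0 x "Suc x"] arc_Suc[of x] by simp
  qed
  \<comment> \<open>\<open>connected\<close> means strong connectivity of the symmetric closure;
    \<open>ring\<close> is symmetric already, so paths through vertex 0 suffice.\<close>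
  have "strongly_connected (with_proj (mk_symmetric (with_proj ring)))"
  proof (rule strongly_connectedI)
    show "verts (with_proj (mk_symmetric (with_proj ring))) \<noteq> {}"
      using m by (auto simp: mk_symmetric_def pverts_ring lessThan_empty_iff)
    fix u v
    assume "u \<in> verts (with_proj (mk_symmetric (with_proj ring)))"
      and "v \<in> verts (with_proj (mk_symmetric (with_proj ring)))"
    then have "u < m * (d + 1)" "v < m * (d + 1)"
      by (simp_all add: mk_symmetric_def pverts_ring)
    then have "u \<rightarrow>\<^sup>*\<^bsub>with_proj ring\<^esub> v"
      using reach G.symmetric_reachable' G.reachable_trans by blast
    then show "u \<rightarrow>\<^sup>*\<^bsub>with_proj (mk_symmetric (with_proj ring))\<^esub> v"
      by (rule G.reachable_mk_symmetricI)
  qed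
  then show ?thesis by (simp add: Digraph_Component.connected_def)
qed

section \<open>Counting colourings\<close>

text \<open>Proper colourings of the complete graph minus the edge between positions
  \<open>0\<close> and \<open>d\<close>, with \<open>d\<close> split off to be coloured
  last.\<close>

definition block_colourings :: "(nat \<Rightarrow> nat) set" where
  "block_colourings =
     {f \<in> {..d} \<rightarrow>\<^sub>E {1..d + 1}. inj_on f {..<d} \<and> f d \<notin> f ` {1..<d}}"

text \<open>There are \<open>(d + 1)!\<close> injections on the first \<open>d\<close> positions;
  the \<open>d - 1\<close> distinct colours at positions \<open>1\<close> to \<open>d - 1\<close>
  then leave two for position \<open>d\<close>.\<close>

lemma card_block_colourings: "card block_colourings \<le> 2 * fact (d + 1)"
proof -
  define I where "I = {f \<in> {..<d} \<rightarrow>\<^sub>E {1..d + 1}. inj_on f {..<d}}"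
  define S where "S = Sigma I (\<lambda>f. {1..d + 1} - f ` {1..<d})"
  have finI: "finite I"
    unfolding I_def by (rule finite_subset[OF _ finite_PiE[of "{..<d}" "\<lambda>_. {1..d + 1}"]]) auto
  have cardI: "card I = fact (d + 1)"
  proof -
    have "card I = (\<Prod>i<d. d + 1 - i)"
      unfolding I_def by (subst card_inj_funcset) auto
    \<comment> \<open>The extra factor, for \<open>i = d\<close>, is 1.\<close>
    also have "\<dots> = (\<Prod>i<Suc d. Suc d - i)" by simp
    also have "\<dots> = fact (d + 1)" by (simp only: prod_diff_eq_fact Suc_eq_plus1)
    finally show ?thesis .
  qed
  have two: "card ({1..d + 1} - f ` {1..<d}) = 2" if "f \<in> I" for f
  proof -
    have "inj_on f {1..<d}" "f ` {1..<d} \<subseteq> {1..d + 1}"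
      using that by (auto simp: I_def inj_on_def)
    then show ?thesis using d by (subst card_Diff_subset) (auto simp: card_image)
  qed
  have "card S = (\<Sum>f\<in>I. card ({1..d + 1} - f ` {1..<d}))"
    unfolding S_def using finI by (intro card_SigmaI) auto
  also have "\<dots> = 2 * fact (d + 1)" using two cardI by simp
  finally have cardS: "card S = 2 * fact (d + 1)" .
  have "inj_on (\<lambda>f. (restrict f {..<d}, f d)) block_colourings"
  proof (rule inj_onI)
    fix f g assume f: "f \<in> block_colourings" and g: "g \<in> block_colourings"
      and eq: "(restrict f {..<d}, f d) = (restrict g {..<d}, g d)"
    show "f = g"
    proof (rule PiE_ext)
      show "f \<in> {..d} \<rightarrow>\<^sub>E {1..d + 1}" "g \<in> {..d} \<rightarrow>\<^sub>E {1..d + 1}"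
        using f g by (auto simp: block_colourings_def)
      fix x assume "x \<in> {..d}"
      then consider "x < d" | "x = d" by fastforce
      then show "f x = g x"
      proof cases
        case 1
        then have "restrict f {..<d} x = restrict g {..<d} x" using eq by simp
        then show ?thesis using 1 by simp
      next
        case 2
        then show ?thesis using eq by simp
      qed
    qed
  qed
  moreover have "(\<lambda>f. (restrict f {..<d}, f d)) ` block_colourings \<subseteq> S"
  proof (rule image_subsetI)
    fix f assume f: "f \<in> block_colourings"
    have "restrict f {..<d} ` {1..<d} = f ` {1..<d}" by (rule image_cong) auto
    moreover have "inj_on (restrict f {..<d}) {..<d}"
      using f by (simp add: block_colourings_def inj_on_def)
    ultimately show "(restrict f {..<d}, f d) \<in> S"
      using f by (auto simp: S_def I_def block_colourings_def)
  qed
  \<comment> \<open>Infinite sets have cardinality 0, so a positive one proves finiteness.\<close>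
  moreover have "finite S" using cardS by (intro card_ge_0_finite) simp
  ultimately show ?thesis using card_inj_on_le cardS by metis
qed

lemma proper_block:
  assumes "\<alpha> \<in> proper_colourings (d + 1) (with_proj ring)" "i < m"
  shows "(\<lambda>j\<in>{..d}. \<alpha> (i * (d + 1) + j)) \<in> block_colourings"
proof -
  \<comment> \<open>The last premise excludes the deleted edge.\<close>
  have neq: "\<alpha> (i * (d + 1) + j) \<noteq> \<alpha> (i * (d + 1) + k)"
    if "j < k" "k \<le> d" "j > 0 \<or> k < d" for j k
  proof -
    have j: "j \<le> d" using that by simp
    have "nbr (i * (d + 1) + j) k = i * (d + 1) + k"
      unfolding nbr_def vertex_div[OF j] vertex_mod[OF j]
      using that by (auto simp: nbr_block_def simp del: mult_Suc_right)
    then have "(i * (d + 1) + j, i * (d + 1) + k) \<in> parcs ring"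
      unfolding arcs_ring_iff vertex_mod[OF j] using that vertex_less[OF assms(2) j]
      by (metis less_irrefl)
    then show ?thesis
      using assms(1) unfolding proper_colourings_def arcs_ends_ring by blast
  qed
  have range: "\<alpha> (i * (d + 1) + j) \<in> {1..d + 1}" if "j \<le> d" for j
    using assms(1) vertex_less[OF assms(2) that]
    by (auto simp: proper_colourings_def pverts_ring PiE_iff)
  have "inj_on (\<lambda>j. \<alpha> (i * (d + 1) + j)) {..<d}"
    by (rule linorder_inj_onI) (use neq in auto)
  moreover have "\<forall>j \<in> {1..<d}. \<alpha> (i * (d + 1) + j) \<noteq> \<alpha> (i * (d + 1) + d)"
    using neq[of _ d] by fastforce
  then have "\<alpha> (i * (d + 1) + d) \<notin> (\<lambda>j\<in>{..d}. \<alpha> (i * (d + 1) + j)) ` {1..<d}"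
    by (force simp del: mult_Suc_right)
  ultimately show ?thesis
    using range unfolding block_colourings_def by (simp add: inj_on_def)
qed

text \<open>A colouring is determined by its restrictions to the blocks; the edges between blocks
  are ignored, hence only an upper bound.\<close>

lemma card_proper_colourings_le:
  "card (proper_colourings (d + 1) (with_proj ring)) \<le> (2 * fact (d + 1)) ^ m"
proof -
  let ?P = "proper_colourings (d + 1) (with_proj ring)"
  let ?h = "\<lambda>\<alpha>. \<lambda>i\<in>{..<m}. \<lambda>j\<in>{..d}. \<alpha> (i * (d + 1) + j) :: nat"
  have "inj_on ?h ?P"
  proof (rule inj_onI)
    fix \<alpha> \<beta> assume \<alpha>: "\<alpha> \<in> ?P" and \<beta>: "\<beta> \<in> ?P" and eq: "?h \<alpha> = ?h \<beta>"
    show "\<alpha> = \<beta>"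
    proof (rule PiE_ext)
      show "\<alpha> \<in> {..<m * (d + 1)} \<rightarrow>\<^sub>E {1..d + 1}" "\<beta> \<in> {..<m * (d + 1)} \<rightarrow>\<^sub>E {1..d + 1}"
        using \<alpha> \<beta> by (auto simp: proper_colourings_def pverts_ring)
      fix x assume "x \<in> {..<m * (d + 1)}"
      then have "x div (d + 1) < m" by (simp add: block_less[simplified])
      moreover have "?h \<alpha> (x div (d + 1)) (x mod (d + 1)) = ?h \<beta> (x div (d + 1)) (x mod (d + 1))"
        using eq by metis
      ultimately have "\<alpha> (x div (d + 1) * (d + 1) + x mod (d + 1)) =
          \<beta> (x div (d + 1) * (d + 1) + x mod (d + 1))"
        using position_le[of x] by (simp del: div_mult_mod_eq)
      then show "\<alpha> x = \<beta> x" by (simp only: div_mult_mod_eq)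
    qed
  qed
  moreover have "?h ` ?P \<subseteq> {..<m} \<rightarrow>\<^sub>E block_colourings"
    using proper_block by (auto simp del: One_nat_def)
  moreover have "finite block_colourings"
    unfolding block_colourings_def
    by (rule finite_subset[OF _ finite_PiE[of "{..d}" "\<lambda>_. {1..d + 1}"]]) auto
  then have "finite ({..<m} \<rightarrow>\<^sub>E block_colourings)" by (intro finite_PiE) auto
  ultimately have "card ?P \<le> card ({..<m} \<rightarrow>\<^sub>E block_colourings)"
    by (rule card_inj_on_le)
  also have "\<dots> = card block_colourings ^ m" by (simp add: card_funcsetE)
  also have "\<dots> \<le> (2 * fact (d + 1)) ^ m" by (intro power_mono card_block_colourings) simp
  finally show ?thesis .
qed

section \<open>Constructing frozen colourings\<close>

definition inner_colourings :: "(nat \<Rightarrow> nat) set" where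
  "inner_colourings = {f \<in> {1..<d} \<rightarrow>\<^sub>E {2..d}. inj_on f {1..<d}}"

lemma card_inner_colourings: "card inner_colourings = fact (d - 1)"
  unfolding inner_colourings_def using prod_diff_eq_fact[of "d - 1"]
  by (simp add: card_inj_funcset)

text \<open>The restriction supplies \<open>undefined\<close> off the vertex set, as membership in
  \<open>proper_colourings\<close> demands. The ends are coloured alike in all blocks for the sake
  of \<open>assemble_nbr\<close>.\<close>

definition assemble :: "(nat \<Rightarrow> nat \<Rightarrow> nat) \<Rightarrow> nat \<Rightarrow> nat" where
  "assemble g = (\<lambda>x\<in>{..<m * (d + 1)}.
     if x mod (d + 1) = 0 then 1 else if x mod (d + 1) = d then d + 1
     else g (x div (d + 1)) (x mod (d + 1)))"

lemma assemble_vertex: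
  assumes "i < m" "j \<le> d"
  shows "assemble g (i * (d + 1) + j) = (if j = 0 then 1 else if j = d then d + 1 else g i j)"
  using vertex_less[OF assms] unfolding assemble_def
  by (simp only: restrict_apply lessThan_iff vertex_div[OF assms(2)] vertex_mod[OF assms(2)] if_True)

lemma assemble_block_image:
  assumes g: "g \<in> {..<m} \<rightarrow>\<^sub>E inner_colourings" and i: "i < m"
  shows "(\<lambda>j. assemble g (i * (d + 1) + j)) ` {..d} = {1..d + 1}"
proof -
  have gi: "g i ` {1..<d} \<subseteq> {2..d}" "inj_on (g i) {1..<d}"
    using g i by (auto simp: inner_colourings_def PiE_iff)
  \<comment> \<open>An injection between two sets of \<open>d - 1\<close> elements is onto.\<close>
  have "g i ` {1..<d} = {2..d}"
    using gi by (intro card_subset_eq) (auto simp: card_image)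
  moreover have "(\<lambda>j. assemble g (i * (d + 1) + j)) ` {1..<d} = g i ` {1..<d}"
    using i by (intro image_cong) (auto simp: assemble_vertex[simplified])
  moreover have "{..d} = insert 0 (insert d {1..<d})" using d by auto
  moreover have "{1..d + 1} = insert 1 (insert (d + 1) {2..d})" using d by auto
  ultimately show ?thesis
    using d assemble_vertex[OF i, of 0 g] assemble_vertex[OF i, of d g]
    by (simp only: image_insert) simp
qed

text \<open>
  An edge leaving its block meets only positions \<open>0\<close> and \<open>d\<close>, whose colours do not depend on the
  block, so a neighbour may be replaced by the vertex of the own block at the same position.
\<close>

lemma assemble_nbr:
  assumes x: "x < m * (d + 1)" and k: "k \<le> d"
  shows "assemble g (nbr x k) = assemble g (x div (d + 1) * (d + 1) + k)"
  unfolding nbr_def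
    assemble_vertex[OF nbr_block_less[OF block_less[OF x]] k] assemble_vertex[OF block_less[OF x] k]
  using d by (auto simp: nbr_block_def)

text \<open>By \<open>assemble_nbr\<close>, the closed neighbourhood of a vertex shows the colours
  of its block, where each colour occurs exactly once. Existence makes the colouring frozen,
  uniqueness makes it proper.\<close>

lemma frozen_assemble:
  assumes g: "g \<in> {..<m} \<rightarrow>\<^sub>E inner_colourings"
  shows "frozen d (with_proj ring) (assemble g)"
proof -
  note image = assemble_block_image[OF g]
  have split: "x = x div (d + 1) * (d + 1) + x mod (d + 1)" for x
    by (simp only: div_mult_mod_eq)
  \<comment> \<open>The \<open>d + 1\<close> positions map onto \<open>d + 1\<close> colours, hence
    injectively.\<close>
  have inj: "inj_on (\<lambda>j. assemble g (i * (d + 1) + j)) {..d}" if "i < m" for i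
    by (rule eq_card_imp_inj_on) (simp_all only: image[OF that] finite_atMost card_atMost, simp)
  have "assemble g x \<in> {1..d + 1}" if "x < m * (d + 1)" for x
    using image[OF block_less[OF that]] position_le[of x] split[of x]
    by (metis atMost_iff image_eqI)
  then have range: "assemble g \<in> {..<m * (d + 1)} \<rightarrow>\<^sub>E {1..d + 1}"
    by (auto simp: PiE_iff assemble_def)
  have proper: "assemble g x \<noteq> assemble g y" if xy: "(x, y) \<in> parcs ring" for x y
  proof -
    obtain k where x: "x < m * (d + 1)" and k: "k \<le> d" "k \<noteq> x mod (d + 1)" "y = nbr x k"
      using xy by (auto simp: arcs_ring_iff)
    have "assemble g (x div (d + 1) * (d + 1) + x mod (d + 1)) \<noteq>
        assemble g (x div (d + 1) * (d + 1) + k)"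
      using inj_on_contraD[OF inj[OF block_less[OF x]], of "x mod (d + 1)" k] k position_le[of x]
      by auto
    then show ?thesis using assemble_nbr[OF x k(1)] k(3) split[of x] by metis
  qed
  have "\<exists>w \<in> closed_neighbourhood (with_proj ring) v. assemble g w = c"
    if v: "v < m * (d + 1)" and c: "c \<in> {1..d + 1}" for v c
  proof -
    obtain k where k: "k \<le> d" "assemble g (v div (d + 1) * (d + 1) + k) = c"
      using image[OF block_less[OF v]] c by (metis (no_types, lifting) atMost_iff imageE)
    show ?thesis
    proof (cases "k = v mod (d + 1)")
      case True
      then have "assemble g v = c" using k split[of v] by metis
      then show ?thesis by (auto simp: closed_neighbourhood_def)
    next
      case False
      then have "(v, nbr v k) \<in> parcs ring" using v k by (auto simp: arcs_ring_iff)
      then have "nbr v k \<in> closed_neighbourhood (with_proj ring) v"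
        by (simp add: closed_neighbourhood_def neighbourhood_def arcs_ends_ring)
      moreover have "assemble g (nbr v k) = c" using assemble_nbr[OF v k(1)] k(2) by simp
      ultimately show ?thesis by blast
    qed
  qed
  then show ?thesis
    using range proper
    by (auto simp: frozen_def proper_colourings_def arcs_ends_ring pverts_ring)
qed

lemma card_frozen_ge:
  "fact (d - 1) ^ m \<le> card {\<alpha>. frozen d (with_proj ring) \<alpha>}"
proof -
  let ?I = "{..<m} \<rightarrow>\<^sub>E inner_colourings"
  \<comment> \<open>The values \<open>g i j\<close> can be read off at the interior positions;
    elsewhere extensional functions agree.\<close>
  have "inj_on assemble ?I"
  proof (rule inj_onI)
    fix g h assume g: "g \<in> ?I" and h: "h \<in> ?I" and eq: "assemble g = assemble h"
    show "g = h"
    proof (rule PiE_ext[OF g h])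
      fix i assume i: "i \<in> {..<m}"
      show "g i = h i"
      proof (rule PiE_ext)
        show "g i \<in> {1..<d} \<rightarrow>\<^sub>E {2..d}" "h i \<in> {1..<d} \<rightarrow>\<^sub>E {2..d}"
          using g h i by (auto simp: inner_colourings_def PiE_iff)
        fix j assume "j \<in> {1..<d}"
        then show "g i j = h i j"
          using fun_cong[OF eq, of "i * (d + 1) + j"] i by (simp add: assemble_vertex[simplified])
      qed
    qed
  qed
  moreover have "assemble ` ?I \<subseteq> {\<alpha>. frozen d (with_proj ring) \<alpha>}"
    using frozen_assemble by blast
  moreover have "finite {\<alpha>. frozen d (with_proj ring) \<alpha>}"
    by (rule finite_subset[OF _ finite_proper_colourings[of "with_proj ring" "d + 1"]])
      (auto simp: frozen_def pverts_ring)
  ultimately have "card ?I \<le> card {\<alpha>. frozen d (with_proj ring) \<alpha>}"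
    by (rule card_inj_on_le)
  then show ?thesis by (simp add: card_funcsetE card_inner_colourings)
qed

section \<open>Probability bound and conclusion\<close>

lemma prob_frozen_ge:
  "measure_pmf.prob (pmf_of_set (proper_colourings (d + 1) (with_proj ring)))
     {\<alpha>. frozen d (with_proj ring) \<alpha>} \<ge> 1 / (2 * real d * (real d + 1)) ^ m"
proof -
  let ?P = "proper_colourings (d + 1) (with_proj ring)"
  let ?F = "{\<alpha>. frozen d (with_proj ring) \<alpha>}"
  interpret G: pair_graph ring by (rule pair_graph_ring)
  have fin: "finite ?P" by (rule finite_proper_colourings) (simp add: pverts_ring)
  have ne: "?P \<noteq> {}" by (rule G.proper_colourings_nonempty[OF regular_ring])
  \<comment> \<open>Since \<open>(d + 1)! = (d + 1) d (d - 1)!\<close>, the factorials cancel in the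
    quotient of the two counts.\<close>
  have "(2 * fact (d + 1) :: real) = 2 * real d * (real d + 1) * fact (d - 1)"
    using fact_reduce[of d, where 'a = real] d by (simp add: algebra_simps)
  then have "real ((2 * fact (d + 1)) ^ m) = (2 * real d * (real d + 1) * fact (d - 1)) ^ m"
    by (simp only: of_nat_power of_nat_mult of_nat_fact of_nat_numeral)
  then have "real ((2 * fact (d + 1)) ^ m) =
      (2 * real d * (real d + 1)) ^ m * real (fact (d - 1) ^ m)"
    by (simp only: power_mult_distrib of_nat_power of_nat_fact)
  then have "1 / (2 * real d * (real d + 1)) ^ m =
      real (fact (d - 1) ^ m) / real ((2 * fact (d + 1)) ^ m)"
    by simp
  also have "\<dots> \<le> real (card ?F) / real (card ?P)"
    using card_frozen_ge card_proper_colourings_le fin ne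
    by (intro frac_le) (simp_all only: of_nat_le_iff of_nat_0_le_iff of_nat_0_less_iff card_gt_0_iff, simp)
  \<comment> \<open>\<open>measure_pmf_of_set\<close> counts the intersection with the
    support.\<close>
  also have "?F = ?P \<inter> ?F" by (auto simp: frozen_def)
  finally show ?thesis by (simp only: measure_pmf_of_set[OF ne fin])
qed

end

text \<open>For \<open>d \<ge> 3\<close>, \<open>2 (d + 1) \<le> 3 d \<le> d^2\<close> bounds the
  base by \<open>d^3 = exp (3 ln d)\<close>; and \<open>m (d + 1) \<ge> m d\<close> absorbs the
  denominator \<open>d\<close> of the exponent.\<close>

lemma exp_bound:
  fixes d m :: nat
  assumes "d \<ge> 3"
  shows "exp (- (3 * ln (real d) / real d) * real (m * (d + 1)))
    \<le> 1 / (2 * real d * (real d + 1)) ^ m"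
proof -
  have "2 * (real d + 1) \<le> 3 * real d" using assms by simp
  also have "\<dots> \<le> real d * real d" using assms by (intro mult_right_mono) auto
  finally have "2 * real d * (real d + 1) \<le> real d ^ 3"
    using assms by (simp add: power3_eq_cube mult_left_mono)
  then have "(2 * real d * (real d + 1)) ^ m \<le> (real d ^ 3) ^ m"
    by (intro power_mono) auto
  also have "\<dots> = exp (3 * ln (real d) * real m)"
    using assms exp_of_nat_mult[of 3 "ln (real d)"] by (simp add: exp_of_nat2_mult)
  also have "\<dots> \<le> exp (3 * ln (real d) / real d * real (m * (d + 1)))"
    using assms by (simp add: field_simps)
  finally have "(2 * real d * (real d + 1)) ^ m \<le> \<dots>" .
  then show ?thesis
    using assms by (simp add: exp_minus divide_simps)
qed

theorem proposition4:
  fixes n0 \<Delta> :: nat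
  assumes "\<Delta> \<ge> 3"
  shows "\<exists>n \<ge> n0. \<exists>G :: nat pair_pre_digraph.
    pair_graph G \<and> Digraph_Component.connected (with_proj G) \<and> regular \<Delta> (with_proj G) \<and> card (pverts G) = n \<and>
    measure_pmf.prob (pmf_of_set (proper_colourings (\<Delta> + 1) (with_proj G)))
      {\<alpha>. frozen \<Delta> (with_proj G) \<alpha>} \<ge> exp (- (3 * ln (real \<Delta>) / real \<Delta>) * real n)"
proof -
  \<comment> \<open>\<open>Suc n0\<close> blocks: a positive number even for \<open>n0 = 0\<close>,
    and enough for at least \<open>n0\<close> vertices.\<close>
  interpret block_ring \<Delta> "Suc n0" by unfold_locales (use assms in auto)
  have "n0 \<le> Suc n0 * (\<Delta> + 1)" by simp
  moreover have "card (pverts ring) = Suc n0 * (\<Delta> + 1)" by (simp add: pverts_ring)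
  ultimately show ?thesis
    using pair_graph_ring connected_ring regular_ring
      order_trans[OF exp_bound[OF assms] prob_frozen_ge]
    by blast
qed

end
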